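(* For every integer $r>1$ there is a constant $c>0$ (depending only on $r$) such that for every integer $n>1$ there exists a $k$-server private information retrieval protocol with $k\le 3\cdot 2^{r-2}$ and communication complexity $C_k(n)\le n^{c(\log\log n/\log n)^{(r-1)/r}}$.
   Context: A $k$-server private information retrieval protocol involves a user holding an index $i\in[1,n]$ and $k$ servers (databases) each holding the same string $\vec x=(x_1,\dots,x_n)$, where servers do not communicate with each other. The user sends queries to the servers and receives answers, after which the user outputs $x_i$ correctly (with probability 1); privacy requires that for each single server the distribution of the query it receives is independent of $i$ (so no server learns anything about $i$). The communication complexity $C_k(n)$ is the total number of bits exchanged between the user and all $k$ servers. *)

theory Defs
  imports "HOL-Probability.Probability_Mass_Function"
begin

text \<open>
  A one-round information retrieval scheme. The user draws private coins \<open>\<omega>\<close>, sends the bit string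
  \<open>query i \<omega> j\<close> to server \<open>j\<close>, receives the bit string \<open>answer j x q\<close> (a function of the database and
  of the query \<open>q\<close> sent to this server only, as the servers do not communicate), and outputs
  \<open>decode i \<omega> as\<close> from the list of all answers. Message lengths are fixed in advance for each
  server, so that no information can be carried by the length of a message.
  The coins range over \<^typ>\<open>nat\<close> with an arbitrary discrete distribution, which covers every
  countable space of random strings.
\<close>

record pir_scheme =
  coins :: "nat pmf"
  query :: "nat \<Rightarrow> nat \<Rightarrow> nat \<Rightarrow> bool list"
  answer :: "nat \<Rightarrow> bool list \<Rightarrow> bool list \<Rightarrow> bool list"
  decode :: "nat \<Rightarrow> nat \<Rightarrow> bool list list \<Rightarrow> bool"
  query_len :: "nat \<Rightarrow> nat"
  answer_len :: "nat \<Rightarrow> nat"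

definition answers :: "pir_scheme \<Rightarrow> nat \<Rightarrow> bool list \<Rightarrow> nat \<Rightarrow> nat \<Rightarrow> bool list list" where
  "answers P k x i \<omega> = map (\<lambda>j. answer P j x (query P i \<omega> j)) [0..<k]"

text \<open>
  Databases are bit strings of length \<open>n\<close>. Positions and servers are numbered from \<open>0\<close>, so
  \<open>i < n\<close> and \<open>j < k\<close>.
\<close>

definition pir_well_formed :: "nat \<Rightarrow> nat \<Rightarrow> pir_scheme \<Rightarrow> bool" where
  "pir_well_formed k n P \<longleftrightarrow>
    (\<forall>i<n. \<forall>\<omega>\<in>set_pmf (coins P). \<forall>j<k.
       length (query P i \<omega> j) = query_len P j \<and>
       (\<forall>x. length x = n \<longrightarrow> length (answer P j x (query P i \<omega> j)) = answer_len P j))"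

definition pir_correct :: "nat \<Rightarrow> nat \<Rightarrow> pir_scheme \<Rightarrow> bool" where
  "pir_correct k n P \<longleftrightarrow>
    (\<forall>x i. length x = n \<longrightarrow> i < n \<longrightarrow>
       measure_pmf.prob (coins P) {\<omega>. decode P i \<omega> (answers P k x i \<omega>) = x ! i} = 1)"

definition pir_private :: "nat \<Rightarrow> nat \<Rightarrow> pir_scheme \<Rightarrow> bool" where
  "pir_private k n P \<longleftrightarrow>
    (\<forall>j<k. \<forall>i<n. \<forall>i'<n.
       map_pmf (\<lambda>\<omega>. query P i \<omega> j) (coins P) = map_pmf (\<lambda>\<omega>. query P i' \<omega> j) (coins P))"

definition pir_protocol :: "nat \<Rightarrow> nat \<Rightarrow> pir_scheme \<Rightarrow> bool" where
  "pir_protocol k n P \<longleftrightarrow> pir_well_formed k n P \<and> pir_correct k n P \<and> pir_private k n P"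

definition communication_complexity :: "nat \<Rightarrow> pir_scheme \<Rightarrow> nat" where
  "communication_complexity k P = (\<Sum>j<k. query_len P j + answer_len P j)"

text \<open>
  The bound \<open>n powr (c * (ln (ln n) / ln n) powr ((r - 1) / r))\<close> is taken with natural logarithms;
  for \<open>n \<ge> 3\<close> every other base \<open>b\<close> with \<open>1 < b < 3\<close> gives the same bound up to the choice of \<open>c\<close>.
  For \<open>n = 2\<close> the double logarithm is \<open>0\<close> in base \<open>2\<close>, which would allow a total of one bit and
  is impossible; in base \<open>e\<close> it is negative, and \<open>powr\<close> then acts on the absolute value because
  \<open>ln (- x) = ln x\<close>. So the case \<open>n = 2\<close> merely asks for a protocol of constant complexity.
\<close>

end

theory Submission
  imports
    Defs
    "HOL-Number_Theory.Cong"
    "HOL-Algebra.Algebraic_Closure_Type"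
    "HOL-Library.Z2"
begin

text \<open>
  Following Efremenko, the user hides the index \<open>i\<close> by sending \<open>w + b j * v i\<close> with \<open>w\<close> uniform in
  \<open>(Z/mZ)^h\<close>; from the answers it can evaluate the functions \<open>q \<mapsto> (\<Sum>l. x l * g ^ \<langle>u l, q\<rangle>)\<close> at these points,
  where \<open>g ^ m = 1\<close>. If all products \<open>\<langle>u l, v i\<rangle>\<close> with \<open>l \<noteq> i\<close> are non-zero and are \<open>0\<close> or \<open>1\<close>
  modulo every prime factor of \<open>m\<close>, and \<open>\<langle>u i, v i\<rangle> = 0\<close>, then a polynomial with few monomials that
  vanishes at the former powers of \<open>g\<close> and not at \<open>1\<close> isolates \<open>x i\<close>.
  In characteristic 2 there is such a polynomial with three monomials for \<open>m = 511 = 7 * 73\<close>, and each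
  further prime factor doubles the number of monomials (Itoh and Suzuki).
  The vectors come from Grolmusz's set systems: modulo \<open>p\<close>, \<open>card (A \<inter> B) choose (p ^ e - 1)\<close>
  tells whether \<open>p ^ e\<close> divides \<open>card (A \<inter> B) + 1\<close>, and it is an inner product of
  incidence vectors. With all prime powers of size about \<open>Q\<close>, sets of \<open>Q ^ r\<close> elements reach
  \<open>n = Q ^ Q ^ r\<close> indices in dimension \<open>Q ^ O(Q)\<close>.
\<close>

hide_const (open) Divisibility.prime

section \<open>Decoding polynomials\<close>

text \<open>
  For squarefree \<open>m\<close> the idempotents modulo \<open>m\<close> are the residues that are \<open>0\<close> or \<open>1\<close> modulo every
  prime factor; the polynomial in question is \<open>\<Sum>j<k. c j * X ^ b j\<close>.
\<close>

definition decoder :: "nat \<Rightarrow> 'a::field \<Rightarrow> nat \<Rightarrow> (nat \<Rightarrow> 'a) \<Rightarrow> (nat \<Rightarrow> nat) \<Rightarrow> bool" where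
  "decoder m g k c b \<longleftrightarrow> g ^ m = 1 \<and> (\<Sum>j<k. c j) \<noteq> 0 \<and>
     (\<forall>s. [s\<^sup>2 = s] (mod m) \<longrightarrow> \<not> m dvd s \<longrightarrow> (\<Sum>j<k. c j * g ^ (b j * s)) = 0)"

lemma cong_square_prime_iff:
  fixes p s :: nat
  assumes "prime p"
  shows "[s\<^sup>2 = s] (mod p) \<longleftrightarrow> [s = 0] (mod p) \<or> [s = 1] (mod p)"
proof -
  have "[s\<^sup>2 = s] (mod p) \<longleftrightarrow> int p dvd int s * (int s - 1)"
    by (simp add: cong_int_iff [symmetric] cong_iff_dvd_diff algebra_simps power2_eq_square)
  also have "\<dots> \<longleftrightarrow> int p dvd int s \<or> int p dvd int s - 1"
    using assms by (intro prime_dvd_mult_iff) simp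
  also have "\<dots> \<longleftrightarrow> [s = 0] (mod p) \<or> [s = 1] (mod p)"
    by (simp add: cong_int_iff [symmetric] cong_iff_dvd_diff)
  finally show ?thesis .
qed

lemma power_cong_exponent:
  fixes z :: "'a::monoid_mult"
  assumes "z ^ m = 1" "[a = b] (mod m)"
  shows "z ^ a = z ^ b"
proof -
  have "z ^ x = z ^ (x mod m)" for x
    using assms(1) by (metis mult_div_mod_eq power_add power_mult power_one mult_1)
  then show ?thesis
    using assms(2) by (metis cong_def)
qed

text \<open>A root of \<open>1 + X + ... + X ^ (p - 1)\<close> works: this polynomial divides
  \<open>X ^ p - 1\<close> and takes the value \<open>p\<close> at 1, which is non-zero in the
  field.\<close>

lemma exists_root_of_unity:
  fixes p :: nat
  assumes "prime p" "(of_nat p :: 'a::alg_closed_field) \<noteq> 0"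
  obtains z :: "'a::alg_closed_field" where "z ^ p = 1" "z \<noteq> 1"
proof -
  have p: "p > 1" using assms(1) prime_gt_1_nat by blast
  obtain z :: 'a where z: "(\<Sum>k\<le>p - 1. 1 * z ^ k) = 0"
    using alg_closed[of "p - 1" "\<lambda>_. 1"] p by auto
  then have z': "(\<Sum>k<p. z ^ k) = 0"
    using p by (metis (no_types, lifting) Suc_diff_1 lessThan_Suc_atMost mult_1 order_less_trans
        sum.cong zero_less_one)
  have "z ^ p = 1"
    using z' geometric_sum[of z p] power_diff_1_eq[of z p] by auto
  moreover have "z \<noteq> 1"
    using z' assms(2) by auto
  ultimately show thesis using that by blast
qed

text \<open>If \<open>D\<close> is the old polynomial, the new one is
  \<open>D(X^e) * (X^f - z)\<close>, where \<open>e\<close> and \<open>f\<close> are the Chinese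
  remainder idempotents. At \<open>(g * z) ^ s\<close> it equals \<open>D(g^s) * (z^s - z)\<close>:
  the first factor treats the \<open>s\<close> not divisible by \<open>m\<close>, the second those
  divisible by \<open>m\<close>, for which \<open>s = 1\<close> modulo \<open>p\<close>.\<close>

lemma decoder_mult_prime:
  fixes g :: "'a::alg_closed_field"
  assumes dec: "decoder m g k c b" and p: "prime p" "coprime m p" and char: "(of_nat p :: 'a) \<noteq> 0"
  shows "\<exists>(g'::'a) c' b'. decoder (m * p) g' (k * 2) c' b'"
proof -
  obtain z :: 'a where z: "z ^ p = 1" "z \<noteq> 1"
    using exists_root_of_unity[OF p(1) char] .
  obtain e where e: "[e = 1] (mod m)" "[e = 0] (mod p)"
    using binary_chinese_remainder_nat[OF p(2)] by blast
  obtain f where f: "[f = 0] (mod m)" "[f = 1] (mod p)"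
    using binary_chinese_remainder_nat[OF p(2)] by blast
  have g: "g ^ m = 1" and c: "(\<Sum>j<k. c j) \<noteq> 0"
    and van: "\<And>s. [s\<^sup>2 = s] (mod m) \<Longrightarrow> \<not> m dvd s \<Longrightarrow> (\<Sum>j<k. c j * g ^ (b j * s)) = 0"
    using dec by (auto simp: decoder_def)
  \<comment> \<open>Expanding the product, the terms \<open>2 * j\<close> and
    \<open>2 * j + 1\<close> come from term \<open>j\<close> times \<open>- z\<close> and times
    \<open>X^f\<close>.\<close>
  define c' where "c' j = c (j div 2) * (if even j then - z else 1)" for j
  define b' where "b' j = b (j div 2) * e + (if even j then 0 else f)" for j
  have split: "(\<Sum>j<k * 2. h j) = (\<Sum>j<k. h (2 * j) + h (2 * j + 1))" for h :: "nat \<Rightarrow> 'a"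
    using sum.nat_group[of h 2 k] by (simp add: mult.commute numeral_2_eq_2)
  have "(\<Sum>j<k * 2. c' j * (g * z) ^ (b' j * s)) = (\<Sum>j<k. c j * g ^ (b j * s)) * (z ^ s - z)" for s
  proof -
    have "g ^ (b j * e * s) = g ^ (b j * s)" for j
      using e(1) by (intro power_cong_exponent[OF g])
        (metis cong_scalar_left cong_scalar_right mult.right_neutral)
    moreover have "z ^ (b j * e * s) = 1" for j
      using e(2) power_cong_exponent[OF z(1), of "b j * e * s" 0] by (simp add: cong_0_iff)
    moreover have "g ^ (f * s) = 1"
      using f(1) power_cong_exponent[OF g, of "f * s" 0] by (simp add: cong_0_iff)
    moreover have "z ^ (f * s) = z ^ s"
      using f(2) by (intro power_cong_exponent[OF z(1)]) (metis cong_scalar_right mult_1)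
    ultimately show ?thesis
      by (simp add: split c'_def b'_def sum_distrib_left sum_distrib_right power_mult_distrib
          distrib_right power_add) (simp add: algebra_simps)
  qed
  note eval = this
  have "(\<Sum>j<k * 2. c' j) \<noteq> 0"
    using eval[of 0] c z(2) by simp
  moreover have "(g * z) ^ (m * p) = 1"
    using g z(1) by (metis mult.commute mult_1 power_mult power_mult_distrib power_one)
  moreover have "(\<Sum>j<k * 2. c' j * (g * z) ^ (b' j * s)) = 0"
    if s: "[s\<^sup>2 = s] (mod m * p)" "\<not> m * p dvd s" for s
  proof (cases "m dvd s")
    case True
    then have "\<not> p dvd s" using s(2) p(2) divides_mult by blast
    moreover have "[s\<^sup>2 = s] (mod p)" using s(1) cong_modulus_mult_nat by (metis mult.commute)
    ultimately have "[s = 1] (mod p)"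
      using cong_square_prime_iff[OF p(1)] by (simp add: cong_0_iff)
    then have "z ^ s = z" using power_cong_exponent[OF z(1)] by fastforce
    then show ?thesis by (simp add: eval)
  next
    case False
    moreover have "[s\<^sup>2 = s] (mod m)" using s(1) cong_modulus_mult_nat by blast
    ultimately show ?thesis by (simp add: eval van)
  qed
  ultimately show ?thesis unfolding decoder_def by blast
qed

text \<open>
  Take \<open>x\<close> of order 7 and \<open>y\<close> of order 73 with \<open>1 + x + x^3 = 0\<close> and \<open>1 + x * y^3 + x^3 * y^5 = 0\<close>. The
  exponents satisfy \<open>362 \<equiv> 5\<close>, \<open>506 \<equiv> 2\<close> modulo 7 and \<open>362 \<equiv> -3\<close>, \<open>506 \<equiv> -5\<close> modulo 73, so that
  \<open>1 + x^3 * y^3 * X^362 + x * y^5 * X^506\<close> becomes one of these two relations at \<open>X = x * y\<close>, \<open>x\<close> and \<open>y\<close>.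
  The cubic for \<open>y\<close> below is its minimal polynomial over the field with 8 elements.
\<close>

lemma decoder_511:
  assumes two: "(2::'a::alg_closed_field) = 0"
  shows "\<exists>(g::'a) c b. decoder 511 g 3 c b"
proof -
  have neg: "- x = x" for x :: 'a
  proof -
    have "x + x = 2 * x" by simp
    then show ?thesis using two by (simp add: minus_unique)
  qed
  have "\<exists>x::'a. (\<Sum>k\<le>3. (if k = 2 then 0 else 1) * x ^ k) = 0"
    by (intro alg_closed) auto
  then obtain x :: 'a where "x ^ 3 + x + 1 = 0"
    by (auto simp: eval_nat_numeral algebra_simps)
  then have x: "x ^ 3 = x + 1"
    by (metis add.assoc neg minus_unique add.commute)
  have "\<exists>y::'a. (\<Sum>k\<le>3. (if k = 0 then 1 else if k = 1 then x else if k = 2 then x ^ 5 else 1) * y ^ k) = 0"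
    by (intro alg_closed) auto
  then obtain y where "y ^ 3 + x ^ 5 * y ^ 2 + x * y + 1 = 0"
    by (auto simp: eval_nat_numeral algebra_simps)
  then have "y ^ 3 = x ^ 5 * y ^ 2 + x * y + 1"
    by (metis add.assoc neg minus_unique add.commute)
  then have "y * (y * y) = x * (x * (x * (x * (x * (y * y))))) + x * y + 1"
    by (simp add: eval_nat_numeral mult.assoc)
  moreover have dbl: "a + a = 0" "a + (a + t) = t" for a t :: 'a
    using neg[of a] by (metis add.right_inverse, metis add.assoc add.left_neutral add.right_inverse)
  moreover have xx: "x * (x * x) = x + 1" "x * (x * (x * t)) = x * t + t" for t
    using x by (simp_all add: eval_nat_numeral mult.assoc [symmetric] distrib_right)
  ultimately have yy: "y * (y * y) = x * (x * (y * y)) + x * (y * y) + y * y + x * y + 1"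
    by (simp add: algebra_simps)
  then have "y * (y * y) * t = (x * (x * (y * y)) + x * (y * y) + y * y + x * y + 1) * t" for t
    by simp
  then have yy': "y * (y * (y * t))
      = x * (x * (y * (y * t))) + x * (y * (y * t)) + y * (y * t) + x * (y * t) + t" for t
    by (simp add: algebra_simps)
  \<comment> \<open>These rules reduce any polynomial in \<open>x\<close> and \<open>y\<close> to
    degree at most 2 in each variable and cancel equal pairs, so identities are decided by
    rewriting.\<close>
  note reduce = xx yy yy' dbl neg eval_nat_numeral algebra_simps
  have x7: "x ^ 7 = 1" by (simp add: reduce)
  have rel: "1 + x * y ^ 3 + x ^ 3 * y ^ 5 = 0" by (simp add: reduce)
  \<comment> \<open>Since \<open>73 = 9 * 8 + 1\<close>, three squarings of \<open>y ^ 9\<close> and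
    one more factor \<open>y\<close> reach \<open>y ^ 73\<close> with small intermediate
    terms.\<close>
  have "y ^ 9 = (x\<^sup>2 + x + 1) + y + (x\<^sup>2 + x + 1) * y\<^sup>2" by (simp add: reduce)
  then have "(y ^ 9)\<^sup>2 = 1 + (x\<^sup>2 + x + 1) * y + x * y\<^sup>2" by (simp only:) (simp add: reduce)
  then have "((y ^ 9)\<^sup>2)\<^sup>2 = (x\<^sup>2 + x) * y + (x\<^sup>2 + x + 1) * y\<^sup>2" by (simp only:) (simp add: reduce)
  then have "(((y ^ 9)\<^sup>2)\<^sup>2)\<^sup>2 = x + (x\<^sup>2 + x + 1) * y + y\<^sup>2" by (simp only:) (simp add: reduce)
  then have "(((y ^ 9)\<^sup>2)\<^sup>2)\<^sup>2 * y = 1" by (simp only:) (simp add: reduce)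
  then have y73: "y ^ 73 = 1" by (simp flip: power_mult power_Suc2)
  define c where "c j = [1, x ^ 3 * y ^ 3, x * y ^ 5] ! j" for j
  define b :: "nat \<Rightarrow> nat" where "b j = [0, 362, 506] ! j" for j
  have sum3: "(\<Sum>j<3. h j) = h 0 + h 1 + h 2" for h :: "nat \<Rightarrow> 'a"
    by (simp add: eval_nat_numeral)
  have "(\<Sum>j<3. c j) \<noteq> 0"
  proof
    assume "(\<Sum>j<3. c j) = 0"
    then have "1 + x ^ 3 * y ^ 3 + x * y ^ 5 = 0" by (simp add: sum3 c_def)
    \<comment> \<open>Adding the relation \<open>rel\<close> produces the common coefficient
      \<open>x ^ 3 + x = 1\<close>, which forces \<open>y = 1\<close>; the cubic for
      \<open>y\<close> then contradicts the one for \<open>x\<close>.\<close>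
    moreover have "y ^ 3 * (y + 1) ^ 2 = (1 + x ^ 3 * y ^ 3 + x * y ^ 5) + (1 + x * y ^ 3 + x ^ 3 * y ^ 5)"
      by (simp add: reduce)
    ultimately have "y ^ 3 * (y + 1) ^ 2 = 0" using rel by simp
    moreover have "y \<noteq> 0" using rel by auto
    ultimately have "y + 1 = 0" by simp
    then have "y = 1" using neg by (metis add_eq_0_iff)
    then have "x * x = 1" using yy by (simp add: dbl algebra_simps)
    then show False using xx(1) by simp
  qed
  moreover have "(x * y) ^ 511 = 1"
  proof -
    have "(x * y) ^ 511 = (x ^ 7) ^ 73 * (y ^ 73) ^ 7"
      by (simp add: power_mult_distrib flip: power_mult)
    then show ?thesis by (simp add: x7 y73)
  qed
  moreover have "(\<Sum>j<3. c j * (x * y) ^ (b j * s)) = 0"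
    if s: "[s\<^sup>2 = s] (mod 511)" "\<not> 511 dvd s" for s
  proof -
    have p: "prime (7::nat)" "prime (73::nat)" by simp_all
    have "coprime (7::nat) 73" using p by (simp add: primes_coprime)
    then have nd: "\<not> (7 dvd s \<and> 73 dvd s)" using s(2) divides_mult[of 7 s 73] by auto
    have "[s\<^sup>2 = s] (mod 7)" "[s\<^sup>2 = s] (mod 73)"
      using s(1) cong_modulus_mult_nat[of _ _ 7 73] cong_modulus_mult_nat[of _ _ 73 7] by simp_all
    then have "[s = 0] (mod 7) \<or> [s = 1] (mod 7)" "[s = 0] (mod 73) \<or> [s = 1] (mod 73)"
      using cong_square_prime_iff p by blast+
    moreover have "[s = 1] (mod 7) \<Longrightarrow> x ^ s = x" "[s = 1] (mod 73) \<Longrightarrow> y ^ s = y"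
       "[s = 0] (mod 7) \<Longrightarrow> x ^ s = 1" "[s = 0] (mod 73) \<Longrightarrow> y ^ s = 1"
      using power_cong_exponent[OF x7] power_cong_exponent[OF y73] by fastforce+
    ultimately have cases: "x ^ s = x \<and> y ^ s = y \<or> x ^ s = x \<and> y ^ s = 1 \<or> x ^ s = 1 \<and> y ^ s = y"
      using nd by (auto simp: cong_0_iff)
    have red: "x ^ 362 = x ^ 5" "x ^ 506 = x ^ 2" "y ^ 362 = y ^ 70" "y ^ 506 = y ^ 68"
      by (auto intro!: power_cong_exponent[OF x7] power_cong_exponent[OF y73] simp: cong_def)
    have X: "(x * y) ^ (e * s) = (x ^ s) ^ e * (y ^ s) ^ e" for e
      by (simp add: power_mult_distrib mult.commute flip: power_mult)
    have split_x: "x ^ 3 = x * x\<^sup>2" "x ^ 7 = x\<^sup>2 * x ^ 5" "x ^ 8 = x ^ 3 * x ^ 5"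
      by (simp_all add: eval_nat_numeral mult.assoc)
    have y': "y ^ 3 * y ^ 70 = 1" "y ^ 5 * y ^ 68 = 1" using y73 by (simp_all flip: power_add)
    have expand: "(\<Sum>j<3. c j * (x * y) ^ (b j * s))
      = 1 + x ^ 3 * y ^ 3 * ((x ^ s) ^ 362 * (y ^ s) ^ 362)
          + x * y ^ 5 * ((x ^ s) ^ 506 * (y ^ s) ^ 506)"
      unfolding sum3 X by (simp add: c_def b_def)
    from cases show ?thesis
    proof (elim disjE conjE)
      assume s: "x ^ s = x" "y ^ s = y"
      have "(\<Sum>j<3. c j * (x * y) ^ (b j * s))
        = 1 + x ^ 8 * (y ^ 3 * y ^ 70) + x ^ 3 * (y ^ 5 * y ^ 68)"
        unfolding expand s red by (simp only: split_x mult_ac)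
      also have "\<dots> = 0" unfolding y' by (simp add: reduce)
      finally show ?thesis .
    next
      assume s: "x ^ s = x" "y ^ s = 1"
      have "(\<Sum>j<3. c j * (x * y) ^ (b j * s)) = 1 + x ^ 7 * x * y ^ 3 + x ^ 3 * y ^ 5"
        unfolding expand s red by (simp only: split_x mult_ac power_one mult_1 mult_1_right)
      then show ?thesis using rel x7 by simp
    next
      assume s: "x ^ s = 1" "y ^ s = y"
      have "(\<Sum>j<3. c j * (x * y) ^ (b j * s)) = 1 + x ^ 3 * (y ^ 3 * y ^ 70) + x * (y ^ 5 * y ^ 68)"
        unfolding expand s red by (simp only: split_x mult_ac power_one mult_1 mult_1_right)
      also have "\<dots> = 0" unfolding y' by (simp add: reduce)
      finally show ?thesis .
    qed
  qed
  ultimately show ?thesis unfolding decoder_def by blast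
qed

section \<open>Matching vectors\<close>

lemma prime_dvd_choose_prime_power:
  fixes p :: nat
  assumes "prime p" "0 < k" "k < p ^ e"
  shows "p dvd p ^ e choose k"
proof (rule ccontr)
  assume "\<not> p dvd p ^ e choose k"
  then have "coprime (p ^ e) (p ^ e choose k)"
    using assms(1) by (simp add: prime_imp_coprime)
  moreover have "p ^ e dvd k * (p ^ e choose k)"
    using times_binomial_minus1_eq[OF assms(2), of "p ^ e"] by simp
  ultimately have "p ^ e dvd k"
    by (simp add: coprime_dvd_mult_left_iff)
  then show False using assms(2,3) by (meson dvd_imp_le not_le)
qed

text \<open>With \<open>q = p ^ e\<close>, Vandermonde's identity for \<open>x = q + y\<close> keeps
  only the term \<open>k = 0\<close> modulo \<open>p\<close>, so the binomial is periodic in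
  \<open>x\<close> with period \<open>q\<close>. Among \<open>0, ..., q - 1\<close> it is non-zero
  only at \<open>q - 1\<close>, where it is 1.\<close>

lemma choose_prime_power_cong:
  fixes p :: nat
  assumes p: "prime p"
  shows "[x choose (p ^ e - 1) = (if p ^ e dvd x + 1 then 1 else 0)] (mod p)"
proof -
  define q where "q = p ^ e"
  have q: "q > 0" using p by (simp add: q_def prime_gt_0_nat)
  have "[x choose (q - 1) = (if q dvd x + 1 then 1 else 0)] (mod p)"
  proof (induction x rule: less_induct)
    case (less x)
    consider "x < q - 1" | "x = q - 1" | "x \<ge> q" by linarith
    then show ?case
    proof cases
      case 1
      then have "\<not> q dvd x + 1" by (auto dest: dvd_imp_le)
      with 1 show ?thesis by (simp add: binomial_eq_0)
    next
      case 2
      then show ?thesis using q by simp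
    next
      case 3
      then obtain y where y: "x = q + y" using le_Suc_ex by blast
      have "x choose (q - 1) = (\<Sum>k\<le>q - 1. (q choose k) * (y choose (q - 1 - k)))"
        unfolding y by (rule vandermonde [symmetric])
      also have "[\<dots> = (\<Sum>k\<le>q - 1. if k = 0 then y choose (q - 1) else 0)] (mod p)"
      proof (rule cong_sum)
        fix k assume k: "k \<in> {..q - 1}"
        show "[(q choose k) * (y choose (q - 1 - k)) = (if k = 0 then y choose (q - 1) else 0)] (mod p)"
        proof (cases "k = 0")
          case False
          then have "p dvd q choose k"
            unfolding q_def using k q q_def by (intro prime_dvd_choose_prime_power[OF p]) auto
          with False show ?thesis by (simp add: cong_0_iff)
        qed simp
      qed
      also have "(\<Sum>k\<le>q - 1. if k = 0 then y choose (q - 1) else 0) = y choose (q - 1)"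
        by simp
      also have "[y choose (q - 1) = (if q dvd y + 1 then 1 else 0)] (mod p)"
        using less y q by simp
      also have "q dvd y + 1 \<longleftrightarrow> q dvd x + 1"
        unfolding y by (metis add.assoc dvd_add_triv_left_iff)
      finally show ?thesis .
    qed
  qed
  then show ?thesis by (simp add: q_def)
qed

section \<open>Forms that are inner products in low dimension\<close>

definition bilinear_rank_on :: "'i set \<Rightarrow> nat \<Rightarrow> ('i \<Rightarrow> 'i \<Rightarrow> nat) \<Rightarrow> bool" where
  "bilinear_rank_on I h F \<longleftrightarrow>
     (\<exists>u v. \<forall>l\<in>I. \<forall>i\<in>I. F l i = (\<Sum>t<h. u l t * v i t))"

lemma bilinear_rank_on_sum_finite:
  assumes "finite T" "\<And>l i. l \<in> I \<Longrightarrow> i \<in> I \<Longrightarrow> F l i = (\<Sum>t\<in>T. u l t * v i t)"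
  shows "bilinear_rank_on I (card T) F"
proof -
  obtain f where f: "bij_betw f {..<card T} T"
    using ex_bij_betw_nat_finite[OF assms(1)] by (auto simp: atLeast0LessThan)
  have "F l i = (\<Sum>t<card T. u l (f t) * v i (f t))" if "l \<in> I" "i \<in> I" for l i
    using sum.reindex_bij_betw[OF f, of "\<lambda>t. u l t * v i t"] assms(2)[OF that] by simp
  then show ?thesis
    unfolding bilinear_rank_on_def
    by (intro exI[of _ "\<lambda>l t. u l (f t)"] exI[of _ "\<lambda>i t. v i (f t)"]) simp
qed

lemma bilinear_rank_on_const: "bilinear_rank_on I 1 (\<lambda>_ _. a)"
  unfolding bilinear_rank_on_def
  by (intro exI[of _ "\<lambda>_ _. a"] exI[of _ "\<lambda>_ _. 1"]) simp

lemma bilinear_rank_on_cmult: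
  assumes "bilinear_rank_on I h F"
  shows "bilinear_rank_on I h (\<lambda>l i. a * F l i)"
proof -
  obtain u v where uv: "\<And>l i. l \<in> I \<Longrightarrow> i \<in> I \<Longrightarrow> F l i = (\<Sum>t<h. u l t * v i t)"
    using assms unfolding bilinear_rank_on_def by blast
  show ?thesis unfolding bilinear_rank_on_def
    by (intro exI[of _ "\<lambda>l t. a * u l t"] exI[of _ v])
      (simp add: uv sum_distrib_left mult.assoc)
qed

lemma bilinear_rank_on_add:
  assumes "bilinear_rank_on I h F" "bilinear_rank_on I h' G"
  shows "bilinear_rank_on I (h + h') (\<lambda>l i. F l i + G l i)"
proof -
  obtain u v where uv: "\<And>l i. l \<in> I \<Longrightarrow> i \<in> I \<Longrightarrow> F l i = (\<Sum>t<h. u l t * v i t)"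
    using assms(1) unfolding bilinear_rank_on_def by blast
  obtain u' v' where uv': "\<And>l i. l \<in> I \<Longrightarrow> i \<in> I \<Longrightarrow> G l i = (\<Sum>t<h'. u' l t * v' i t)"
    using assms(2) unfolding bilinear_rank_on_def by blast
  have split: "(\<Sum>t<h + h'. f t) = (\<Sum>t<h. f t) + (\<Sum>t<h'. f (h + t))" for f :: "nat \<Rightarrow> nat"
    by (induction h') simp_all
  show ?thesis unfolding bilinear_rank_on_def
    by (intro exI[of _ "\<lambda>l t. if t < h then u l t else u' l (t - h)"]
        exI[of _ "\<lambda>i t. if t < h then v i t else v' i (t - h)"]) (simp add: uv uv' split)
qed

lemma bilinear_rank_on_sum:
  assumes "finite P" "\<And>p. p \<in> P \<Longrightarrow> bilinear_rank_on I (h p) (F p)"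
  shows "bilinear_rank_on I (\<Sum>p\<in>P. h p) (\<lambda>l i. \<Sum>p\<in>P. F p l i)"
  using assms
proof (induction P rule: finite_induct)
  case empty
  then show ?case by (simp add: bilinear_rank_on_def)
next
  case (insert p P)
  then show ?case by (simp add: bilinear_rank_on_add)
qed

text \<open>The binomial counts the \<open>k\<close>-subsets lying in both sets, so it is the inner
  product of 0/1 vectors indexed by the \<open>k\<close>-subsets of \<open>{..<N}\<close>.\<close>

lemma bilinear_rank_on_choose_card_Int:
  assumes "\<And>l. l \<in> I \<Longrightarrow> A l \<subseteq> {..<N::nat}"
  shows "bilinear_rank_on I (N choose k) (\<lambda>l i. card (A l \<inter> A i) choose k)"
proof -
  let ?T = "{T. T \<subseteq> {..<N} \<and> card T = k}"
  have fin: "finite ?T" by (rule finite_subset[of _ "Pow {..<N}"]) auto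
  have "card (A l \<inter> A i) choose k = (\<Sum>T\<in>?T. of_bool (T \<subseteq> A l) * of_bool (T \<subseteq> A i))"
    if "l \<in> I" "i \<in> I" for l i
  proof -
    have "finite (A l)" using assms[OF that(1)] finite_subset by blast
    then have "card (A l \<inter> A i) choose k = card {T. T \<subseteq> A l \<inter> A i \<and> card T = k}"
      by (intro n_subsets [symmetric]) simp
    also have "{T. T \<subseteq> A l \<inter> A i \<and> card T = k} = ?T \<inter> {T. T \<subseteq> A l \<and> T \<subseteq> A i}"
      using assms[OF that(1)] by auto
    also have "card \<dots> = (\<Sum>T\<in>?T. of_bool (T \<subseteq> A l \<and> T \<subseteq> A i))"
      using fin by (simp add: sum.If_cases of_bool_def)
    finally show ?thesis by (simp add: of_bool_conj)
  qed
  from bilinear_rank_on_sum_finite[OF fin this] show ?thesis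
    by (simp add: n_subsets)
qed

definition matching_vectors ::
  "nat \<Rightarrow> nat \<Rightarrow> nat \<Rightarrow> (nat \<Rightarrow> nat \<Rightarrow> nat) \<Rightarrow> (nat \<Rightarrow> nat \<Rightarrow> nat) \<Rightarrow> bool" where
  "matching_vectors m n h u v \<longleftrightarrow> (\<forall>l<n. \<forall>i<n.
     [(\<Sum>t<h. u l t * v i t)\<^sup>2 = (\<Sum>t<h. u l t * v i t)] (mod m) \<and>
     (m dvd (\<Sum>t<h. u l t * v i t) \<longleftrightarrow> l = i))"

lemma cong_prod_primes_iff:
  fixes x y :: nat
  assumes "finite P" "\<And>p. p \<in> P \<Longrightarrow> prime p"
  shows "[x = y] (mod (\<Prod>p\<in>P. p ^ e p)) \<longleftrightarrow> (\<forall>p\<in>P. [x = y] (mod p ^ e p))"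
proof
  assume "[x = y] (mod (\<Prod>p\<in>P. p ^ e p))"
  then show "\<forall>p\<in>P. [x = y] (mod p ^ e p)"
    using assms(1) by (meson cong_dvd_modulus_nat dvd_prodI)
next
  assume "\<forall>p\<in>P. [x = y] (mod p ^ e p)"
  then show "[x = y] (mod (\<Prod>p\<in>P. p ^ e p))"
    using assms by (intro coprime_cong_prod_nat) (auto intro!: primes_coprime)
qed

text \<open>Assign to the indices distinct sets of \<open>M - 1\<close> elements, where
  \<open>M\<close> is the product of the \<open>p ^ e p\<close>. Then
  \<open>card (A l \<inter> A i) + 1\<close> lies between 1 and \<open>M\<close>, so
  \<open>M\<close> divides it only if the sets coincide. Divisibility by \<open>M\<close> splits
  into tests for the prime powers, each a binomial modulo \<open>p\<close>.\<close>

lemma exists_matching_vectors: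
  fixes P :: "nat set" and e :: "nat \<Rightarrow> nat"
  assumes P: "finite P" "\<And>p. p \<in> P \<Longrightarrow> prime p"
    and n: "n \<le> N choose ((\<Prod>p\<in>P. p ^ e p) - 1)"
  shows "\<exists>u v. matching_vectors (\<Prod>P) n (1 + (\<Sum>p\<in>P. N choose (p ^ e p - 1))) u v"
proof -
  define M where "M = (\<Prod>p\<in>P. p ^ e p)"
  have M: "M > 0" using P by (auto simp: M_def prime_gt_0_nat intro!: prod_pos)
  have "card {..<n} \<le> card {S. S \<subseteq> {..<N} \<and> card S = M - 1}"
    using n by (simp add: n_subsets M_def)
  then obtain A where A: "A ` {..<n} \<subseteq> {S. S \<subseteq> {..<N} \<and> card S = M - 1}" "inj_on A {..<n}"
    using card_le_inj[of "{..<n}" "{S. S \<subseteq> {..<N} \<and> card S = M - 1}"] by auto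
  then have sub: "A l \<subseteq> {..<N}" and card: "card (A l) = M - 1" if "l < n" for l
    using that by auto
  have fin: "finite (A l)" if "l < n" for l using sub[OF that] finite_subset by blast
  \<comment> \<open>Modulo \<open>p\<close>, the form \<open>F\<close> below is 0 or 1 according to whether \<open>p ^ e p\<close> divides \<open>card (A l \<inter> A i) + 1\<close>; the
    coefficients \<open>a\<close> are minus the idempotents of the Chinese remainder theorem.\<close>
  have "\<exists>x. [x = p - 1] (mod p) \<and> (\<forall>p'\<in>P. p' \<noteq> p \<longrightarrow> [x = 0] (mod p'))" if p: "p \<in> P" for p
  proof -
    have "coprime p (\<Prod>(P - {p}))"
      using P p by (intro prod_coprime_right primes_coprime) auto
    then obtain x where x: "[x = p - 1] (mod p)" "[x = 0] (mod \<Prod>(P - {p}))"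
      using binary_chinese_remainder_nat by blast
    have "[x = 0] (mod p')" if "p' \<in> P" "p' \<noteq> p" for p'
    proof (rule cong_dvd_modulus_nat[OF x(2)])
      show "p' dvd \<Prod>(P - {p})"
        using that P(1) dvd_prodI[of "P - {p}" p' "\<lambda>x. x"] by simp
    qed
    with x(1) show ?thesis by blast
  qed
  then obtain a where a_same: "\<And>p. p \<in> P \<Longrightarrow> [a p = p - 1] (mod p)"
    and a_other: "\<And>p p'. p \<in> P \<Longrightarrow> p' \<in> P \<Longrightarrow> p' \<noteq> p \<Longrightarrow> [a p' = 0] (mod p)"
    by metis
  define F where "F l i = 1 + (\<Sum>p\<in>P. a p * (card (A l \<inter> A i) choose (p ^ e p - 1)))" for l i
  define h where "h = 1 + (\<Sum>p\<in>P. N choose (p ^ e p - 1))"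
  have "bilinear_rank_on {..<n} h F"
    unfolding F_def h_def
    by (intro bilinear_rank_on_add bilinear_rank_on_const bilinear_rank_on_sum bilinear_rank_on_cmult
        bilinear_rank_on_choose_card_Int P(1)) (use sub in auto)
  then obtain u v where uv: "\<And>l i. l < n \<Longrightarrow> i < n \<Longrightarrow>
      F l i = (\<Sum>t<h. u l t * v i t)"
    unfolding bilinear_rank_on_def by blast
  have F: "[F l i = (if p ^ e p dvd card (A l \<inter> A i) + 1 then 0 else 1)] (mod p)" if p: "p \<in> P" for p l i
  proof -
    let ?x = "card (A l \<inter> A i)"
    have "F l i = 1 + (a p * (?x choose (p ^ e p - 1))
        + (\<Sum>p'\<in>P - {p}. a p' * (?x choose (p' ^ e p' - 1))))"
      unfolding F_def using P p by (simp add: sum.remove)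
    also have "[\<dots> = 1 + ((p - 1) * (if p ^ e p dvd ?x + 1 then 1 else 0) + (\<Sum>p'\<in>P - {p}. 0))] (mod p)"
      using p by (intro cong_add cong_mult cong_refl a_same choose_prime_power_cong P cong_sum)
        (use a_other[OF p] in \<open>auto simp: cong_0_iff\<close>)
    also have "[1 + ((p - 1) * (if p ^ e p dvd ?x + 1 then 1 else 0) + (\<Sum>p'\<in>P - {p}. 0))
        = (if p ^ e p dvd ?x + 1 then 0 else 1)] (mod p)"
      using prime_gt_0_nat[OF P(2)[OF p]] by (simp add: cong_0_iff)
    finally show ?thesis .
  qed
  have "[(F l i)\<^sup>2 = F l i] (mod \<Prod>P)" for l i
  proof -
    have "[(F l i)\<^sup>2 = F l i] (mod p)" if p: "p \<in> P" for p
    proof -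
      have "[F l i = 0] (mod p) \<or> [F l i = 1] (mod p)" using F[OF p, of l i] by (auto split: if_splits)
      then show ?thesis
        by (metis cong_pow cong_sym cong_trans power_one zero_power2)
    qed
    then show ?thesis using cong_prod_primes_iff[OF P, where e = "\<lambda>_. 1"] by simp
  qed
  moreover have "\<Prod>P dvd F l i \<longleftrightarrow> l = i" if li: "l < n" "i < n" for l i
  proof -
    let ?x = "card (A l \<inter> A i)"
    have "\<Prod>P dvd F l i \<longleftrightarrow> (\<forall>p\<in>P. p dvd F l i)"
      using cong_prod_primes_iff[OF P, where e = "\<lambda>_. 1" and y = 0] by (simp add: cong_0_iff)
    also have "\<dots> \<longleftrightarrow> (\<forall>p\<in>P. p ^ e p dvd ?x + 1)"
    proof (intro ball_cong refl)
      fix p assume p: "p \<in> P"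
      have "\<not> p dvd 1" using P(2)[OF p] not_prime_unit by blast
      then show "p dvd F l i \<longleftrightarrow> p ^ e p dvd ?x + 1"
        using F[OF p, of l i] cong_dvd_iff[OF F[OF p, of l i]] by (metis cong_0_iff cong_dvd_iff)
    qed
    also have "\<dots> \<longleftrightarrow> M dvd ?x + 1"
      using cong_prod_primes_iff[OF P, where e = e and y = 0] by (simp add: cong_0_iff M_def)
    also have "\<dots> \<longleftrightarrow> ?x = M - 1"
    proof -
      have "?x \<le> M - 1" using card_mono[of "A l" "A l \<inter> A i"] fin li card by auto
      then show ?thesis using M by (auto dest: dvd_imp_le)
    qed
    also have "\<dots> \<longleftrightarrow> l = i"
    proof
      assume "?x = M - 1"
      then have "A l \<inter> A i = A l" "A l \<inter> A i = A i"
        using fin li card by (metis card_subset_eq inf_le1, metis card_subset_eq inf_le2)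
      then show "l = i" using A(2) li by (auto dest: inj_onD)
    qed (use card li in simp)
    finally show ?thesis .
  qed
  ultimately show ?thesis
    unfolding matching_vectors_def h_def [symmetric]
    by (intro exI[of _ u] exI[of _ v]) (simp add: uv [symmetric])
qed

section \<open>The protocol\<close>

definition residue_vectors :: "nat \<Rightarrow> nat \<Rightarrow> nat list set" where
  "residue_vectors m h = {w. set w \<subseteq> {..<m} \<and> length w = h}"

lemma finite_residue_vectors: "finite (residue_vectors m h)"
  unfolding residue_vectors_def by (rule finite_lists_length_eq) simp

lemma residue_vectors_nonempty: "m > 0 \<Longrightarrow> residue_vectors m h \<noteq> {}"
  by (auto simp: residue_vectors_def intro!: exI[of _ "replicate h 0"])

definition shift_residues :: "nat \<Rightarrow> (nat \<Rightarrow> nat) \<Rightarrow> nat list \<Rightarrow> nat list" where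
  "shift_residues m d w = map (\<lambda>t. (w ! t + d t) mod m) [0..<length w]"

text \<open>Translations of \<open>(Z/mZ)^h\<close> are injective. Hence a shifted uniform vector is
  again uniform, which gives privacy.\<close>

lemma bij_betw_shift_residues:
  assumes "m > 0"
  shows "bij_betw (shift_residues m d) (residue_vectors m h) (residue_vectors m h)"
proof -
  have "inj_on (shift_residues m d) (residue_vectors m h)"
  proof (rule inj_onI, rule nth_equalityI)
    fix w w' assume w: "w \<in> residue_vectors m h" "w' \<in> residue_vectors m h"
      and eq: "shift_residues m d w = shift_residues m d w'"
    then show len: "length w = length w'" by (simp add: residue_vectors_def)
    fix t assume t: "t < length w"
    then have "(w ! t + d t) mod m = (w' ! t + d t) mod m"
      using arg_cong[OF eq, of "\<lambda>l. l ! t"] len by (simp add: shift_residues_def)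
    then have "[w ! t = w' ! t] (mod m)"
      by (simp add: cong_add_rcancel_nat flip: cong_def)
    moreover have "w ! t < m" "w' ! t < m"
      using w t len subsetD[OF _ nth_mem, of _ "{..<m}"] by (auto simp: residue_vectors_def)
    ultimately show "w ! t = w' ! t" by (simp add: cong_less_modulus_unique_nat)
  qed
  moreover have "shift_residues m d ` residue_vectors m h \<subseteq> residue_vectors m h"
    using assms by (auto simp: shift_residues_def residue_vectors_def)
  ultimately show ?thesis
    using finite_residue_vectors by (simp add: bij_betw_def endo_inj_surj)
qed

text \<open>Spending \<open>m\<close> bits on each residue is wasteful, but \<open>m\<close> will
  depend only on \<open>r\<close>, so only constants are affected.\<close>

lemma exists_residue_vector_encoding:
  obtains enc :: "nat list \<Rightarrow> bool list"
  where "inj_on enc (residue_vectors m h)" "\<And>w. w \<in> residue_vectors m h \<Longrightarrow> length (enc w) = h * m"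
proof -
  let ?B = "{bs :: bool list. set bs \<subseteq> UNIV \<and> length bs = h * m}"
  have "m ^ h \<le> (2 ^ m) ^ h" by (intro power_mono) (simp_all add: less_imp_le)
  then have "card (residue_vectors m h) \<le> card ?B"
    using card_lists_length_eq[of "{..<m}" h] card_lists_length_eq[of "UNIV::bool set" "h * m"]
    by (simp add: residue_vectors_def card_UNIV_bool mult.commute flip: power_mult)
  moreover have "finite ?B" by (rule finite_lists_length_eq) simp
  ultimately obtain enc where "enc ` residue_vectors m h \<subseteq> ?B" "inj_on enc (residue_vectors m h)"
    using card_le_inj[OF finite_residue_vectors] by blast
  then show thesis using that[of enc] by auto
qed

lemma of_nat_eq_of_bool_odd:
  assumes "(2 :: 'a::ring_1) = 0"
  shows "(of_nat N :: 'a) = of_bool (odd N)"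
proof -
  have "(of_nat N :: 'a) = of_nat (N mod 2) + 2 * of_nat (N div 2)"
    by (metis mod_mult_div_eq of_nat_add of_nat_mult of_nat_numeral)
  then show ?thesis using assms by (simp add: mod2_eq_if)
qed

text \<open>
  The powers of \<open>g\<close> may live in an infinite field, so a server does not send
  \<open>\<Sum>l | x ! l. g ^ \<langle>u l, w\<rangle>\<close> itself but its coordinates in the group algebra of \<open>Z/mZ\<close> over two elements.
\<close>

definition parity_answer ::
  "nat \<Rightarrow> nat \<Rightarrow> nat \<Rightarrow> (nat \<Rightarrow> nat \<Rightarrow> nat) \<Rightarrow> bool list \<Rightarrow> nat list \<Rightarrow> bool list" where
  "parity_answer m n h u x w =
     map (\<lambda>s. odd (card {l\<in>{..<n}. x ! l \<and> (\<Sum>t<h. u l t * w ! t) mod m = s})) [0..<m]"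

text \<open>Grouping the indices \<open>l\<close> by the residue of the exponent gives
  multiplicities times powers of \<open>g\<close>; in characteristic 2 only the parities of the
  multiplicities matter.\<close>

lemma parity_answer_eval:
  fixes g :: "'a::field"
  assumes "(2 :: 'a) = 0" "g ^ m = 1" "m > 0"
  shows "(\<Sum>s<m. of_bool (parity_answer m n h u x w ! s) * g ^ s)
    = (\<Sum>l | l < n \<and> x ! l. g ^ (\<Sum>t<h. u l t * w ! t))"
proof -
  let ?L = "{l. l < n \<and> x ! l}" and ?f = "\<lambda>l. (\<Sum>t<h. u l t * w ! t)"
  have "(\<Sum>s<m. of_bool (parity_answer m n h u x w ! s) * g ^ s)
      = (\<Sum>s<m. \<Sum>l\<in>{l\<in>?L. ?f l mod m = s}. g ^ (?f l mod m))"
  proof (intro sum.cong refl)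
    fix s assume "s \<in> {..<m}"
    then have "of_bool (parity_answer m n h u x w ! s) * g ^ s
        = of_nat (card {l\<in>{..<n}. x ! l \<and> ?f l mod m = s}) * g ^ s"
      by (simp add: parity_answer_def of_nat_eq_of_bool_odd[OF assms(1)])
    also have "\<dots> = (\<Sum>l\<in>{l\<in>?L. ?f l mod m = s}. g ^ (?f l mod m))"
      by (simp add: conj_assoc)
    finally show "of_bool (parity_answer m n h u x w ! s) * g ^ s
      = (\<Sum>l\<in>{l\<in>?L. ?f l mod m = s}. g ^ (?f l mod m))" .
  qed
  also have "\<dots> = (\<Sum>l\<in>?L. g ^ (?f l mod m))"
    using assms(3) by (intro sum.group) auto
  also have "\<dots> = (\<Sum>l\<in>?L. g ^ ?f l)"
    by (intro sum.cong refl power_cong_exponent[OF assms(2)]) (simp add: cong_def)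
  finally show ?thesis .
qed

text \<open>Let \<open>D\<close> be the decoding polynomial. Combining the evaluated answers with
  weights \<open>c j\<close> yields the sum over \<open>l\<close> with \<open>x ! l\<close> of
  \<open>g ^ \<langle>u l, w\<rangle> * D(g ^ \<langle>u l, v i\<rangle>)\<close>. Only
  \<open>l = i\<close> survives, with a non-zero coefficient, so testing for non-zero recovers the
  bit.\<close>

lemma pir_from_decoder:
  fixes g :: "'a::field"
  assumes two: "(2 :: 'a) = 0" and m: "m > 0"
    and dec: "decoder m g k c b" and mv: "matching_vectors m n h u v"
  shows "\<exists>P. pir_protocol k n P \<and> communication_complexity k P = k * (h * m + m)"
proof -
  let ?W = "residue_vectors m h"
  obtain enc :: "nat list \<Rightarrow> bool list" where enc: "inj_on enc ?W"
    and len: "\<And>w. w \<in> ?W \<Longrightarrow> length (enc w) = h * m"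
    using exists_residue_vector_encoding[of m h] by blast
  define q where "q i w j = shift_residues m (\<lambda>t. b j * v i t) w" for i w j
  define eval where "eval as = (\<Sum>j<k. c j * (\<Sum>s<m. of_bool (as ! j ! s) * g ^ s))" for as
  define P where "P = \<lparr>
    coins = map_pmf to_nat (pmf_of_set ?W),
    query = (\<lambda>i \<omega> j. enc (q i (from_nat \<omega>) j)),
    answer = (\<lambda>_ x bs. parity_answer m n h u x (inv_into ?W enc bs)),
    decode = (\<lambda>_ _ as. eval as \<noteq> 0),
    query_len = (\<lambda>_. h * m),
    answer_len = (\<lambda>_. m) \<rparr>"
  have coins: "coins P = map_pmf to_nat (pmf_of_set ?W)"
    and query: "query P i (to_nat w) j = enc (q i w j)"
    and answer: "answer P j x bs = parity_answer m n h u x (inv_into ?W enc bs)"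
    and decode: "decode P i \<omega> as \<longleftrightarrow> eval as \<noteq> 0"
    and lens: "query_len P j = h * m" "answer_len P j = m"
    for i w j x bs \<omega> as by (simp_all add: P_def)
  have W: "finite ?W" "?W \<noteq> {}"
    using finite_residue_vectors residue_vectors_nonempty[OF m] by auto
  have set_coins: "set_pmf (coins P) = to_nat ` ?W"
    unfolding coins by (simp add: W)
  have q: "q i w j \<in> ?W" if "w \<in> ?W" for i w j
    using bij_betw_apply[OF bij_betw_shift_residues[OF m] that] by (simp add: q_def)
  have "pir_well_formed k n P"
    unfolding pir_well_formed_def by (auto simp: set_coins query answer lens len q parity_answer_def)
  moreover have "pir_private k n P"
  proof -
    have "map_pmf (\<lambda>\<omega>. query P i \<omega> j) (coins P) = map_pmf enc (pmf_of_set ?W)" for i j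
    proof -
      have "map_pmf (\<lambda>\<omega>. query P i \<omega> j) (coins P)
          = map_pmf enc (map_pmf (shift_residues m (\<lambda>t. b j * v i t)) (pmf_of_set ?W))"
        unfolding coins pmf.map_comp by (simp add: comp_def query q_def)
      also have "\<dots> = map_pmf enc (pmf_of_set ?W)"
        using map_pmf_of_set_bij_betw[OF bij_betw_shift_residues[OF m]] W by metis
      finally show ?thesis .
    qed
    then show ?thesis unfolding pir_private_def by simp
  qed
  moreover have "pir_correct k n P"
  proof -
    have g: "g ^ m = 1" and c: "(\<Sum>j<k. c j) \<noteq> 0" and van: "\<And>s. [s\<^sup>2 = s] (mod m) \<Longrightarrow> \<not> m dvd s \<Longrightarrow>
        (\<Sum>j<k. c j * g ^ (b j * s)) = 0"
      using dec by (auto simp: decoder_def)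
    then have "g \<noteq> 0" using m by (metis power_0_left not_gr_zero zero_neq_one)
    have "decode P i (to_nat w) (answers P k x i (to_nat w)) = x ! i"
      if i: "i < n" and x: "length x = n" and w: "w \<in> ?W" for i x w
    proof -
      let ?L = "{l. l < n \<and> x ! l}"
      define uw where "uw l = (\<Sum>t<h. u l t * w ! t)" for l
      define uv where "uv l = (\<Sum>t<h. u l t * v i t)" for l
      have dot: "g ^ (\<Sum>t<h. u l t * q i w j ! t) = g ^ uw l * g ^ (b j * uv l)" for l j
      proof -
        have "length w = h" using w by (simp add: residue_vectors_def)
        then have "[(\<Sum>t<h. u l t * q i w j ! t) = (\<Sum>t<h. u l t * (w ! t + b j * v i t))] (mod m)"
          by (intro cong_sum cong_mult cong_refl) (simp add: q_def shift_residues_def cong_def)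
        also have "(\<Sum>t<h. u l t * (w ! t + b j * v i t)) = uw l + b j * uv l"
          by (simp add: uw_def uv_def sum_distrib_left distrib_left sum.distrib mult.left_commute)
        finally show ?thesis
          using power_cong_exponent[OF g] by (metis power_add)
      qed
      have collapse: "(\<Sum>j<k. c j * g ^ (b j * uv l)) = (if l = i then \<Sum>j<k. c j else 0)" if "l < n" for l
      proof (cases "l = i")
        case True
        then have "m dvd uv l" using mv i by (simp add: matching_vectors_def uv_def)
        then have "g ^ (b j * uv l) = 1" for j
          using power_cong_exponent[OF g, of "b j * uv l" 0] by (simp add: cong_0_iff)
        with True show ?thesis by simp
      next
        case False
        then have "[(uv l)\<^sup>2 = uv l] (mod m)" "\<not> m dvd uv l"
          using mv i that by (simp_all add: matching_vectors_def uv_def)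
        with False van show ?thesis by simp
      qed
      have "eval (answers P k x i (to_nat w))
          = (\<Sum>j<k. c j * (\<Sum>l\<in>?L. g ^ (\<Sum>t<h. u l t * q i w j ! t)))"
        unfolding eval_def
        by (intro sum.cong refl)
          (simp add: answers_def answer query inv_into_f_f[OF enc q[OF w]] parity_answer_eval[OF two g m])
      also have "\<dots> = (\<Sum>l\<in>?L. \<Sum>j<k. c j * (g ^ uw l * g ^ (b j * uv l)))"
        unfolding dot sum_distrib_left by (rule sum.swap)
      also have "\<dots> = (\<Sum>l\<in>?L. g ^ uw l * (\<Sum>j<k. c j * g ^ (b j * uv l)))"
        by (simp add: sum_distrib_left mult.left_commute)
      also have "\<dots> = (\<Sum>l\<in>?L. if l = i then g ^ uw i * (\<Sum>j<k. c j) else 0)"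
        by (intro sum.cong refl) (simp add: collapse)
      also have "\<dots> = (if x ! i then g ^ uw i * (\<Sum>j<k. c j) else 0)"
        using i by simp
      finally show ?thesis
        using c \<open>g \<noteq> 0\<close> by (simp add: decode)
    qed
    then have "measure_pmf.prob (coins P) {\<omega>. decode P i \<omega> (answers P k x i \<omega>) = x ! i} = 1"
      if "length x = n" "i < n" for x i
      using that by (subst measure_pmf.prob_eq_1) (auto simp: AE_measure_pmf_iff set_coins)
    then show ?thesis unfolding pir_correct_def by blast
  qed
  ultimately have "pir_protocol k n P" by (simp add: pir_protocol_def)
  moreover have "communication_complexity k P = k * (h * m + m)"
    by (simp add: communication_complexity_def lens)
  ultimately show ?thesis by blast
qed

text \<open>An empty query is trivially private. This covers the finitely many small
  \<open>n\<close>.\<close>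

lemma pir_send_database:
  "\<exists>P. pir_protocol 1 n P \<and> communication_complexity 1 P = n"
proof -
  define P where "P = \<lparr> coins = return_pmf 0, query = (\<lambda>_ _ _. []), answer = (\<lambda>_ x _. x),
    decode = (\<lambda>i _ as. as ! 0 ! i), query_len = (\<lambda>_. 0), answer_len = (\<lambda>_. n) \<rparr>"
  have "pir_protocol 1 n P"
    by (simp add: P_def pir_protocol_def pir_well_formed_def pir_correct_def pir_private_def
        answers_def measure_return_pmf)
  moreover have "communication_complexity 1 P = n"
    by (simp add: P_def communication_complexity_def)
  ultimately show ?thesis by blast
qed

section \<open>Choice of parameters\<close>

text \<open>The logarithm of the left side is \<open>O(Q * ln Q)\<close>, and
  \<open>(Q * ln Q) ^ r = Q ^ r * ln Q * (ln Q) ^ (r - 1)\<close>. Here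
  \<open>Q ^ r * ln Q = O(ln n)\<close> and \<open>ln Q = O(ln (ln n))\<close>, so this is
  \<open>O(T ^ r)\<close>.\<close>

lemma pir_bound_asymptotics:
  fixes r K B :: nat
  assumes "r > 1" "K \<ge> 1" "B \<ge> 1"
  shows "\<exists>c>0. \<forall>n>3 ^ (3 ^ r). \<exists>Q\<ge>1. n \<le> Q ^ (Q ^ r) \<and>
    real (K * (B * Q) ^ (B * Q))
      \<le> real n powr (c * (ln (ln (real n)) / ln (real n)) powr ((real r - 1) / real r))"
proof -
  \<comment> \<open>The two factors come from \<open>key\<close> and from the power
    \<open>r - 1\<close> of \<open>L_le\<close>; \<open>C'\<close> collects the contributions of
    \<open>K\<close> and \<open>B\<close>.\<close>
  define C where "C = 2 ^ (r + 1) * (real r + 2) ^ (r - 1)"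
  define C' where "C' = ln (real K) + real B * (ln (real B) + 1)"
  have C1: "C \<ge> 1"
  proof -
    have "1 * 1 \<le> C" unfolding C_def by (intro mult_mono one_le_power) auto
    then show ?thesis by simp
  qed
  have C': "C' > 0" unfolding C'_def using assms by (intro add_nonneg_pos mult_pos_pos) (auto intro: add_nonneg_pos)
  show ?thesis
  proof (intro exI[of _ "C' * C"] conjI allI impI)
    show "C' * C > 0" using C1 C' by simp
  next
    fix n :: nat assume n: "n > 3 ^ (3 ^ r)"
    \<comment> \<open>By minimality \<open>(Q - 1) ^ r * ln (Q - 1) < ln n\<close>, i.e. \<open>Q\<close> is of order \<open>(ln n / ln (ln n)) powr (1 / r)\<close>;
      the bound needed is \<open>Q * ln Q = O(T)\<close>.\<close>
    define Q where "Q = (LEAST Q. n \<le> Q ^ (Q ^ r))"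
    have "n \<le> n ^ (n ^ r)" using n by (intro self_le_power) auto
    then have Q: "n \<le> Q ^ (Q ^ r)" unfolding Q_def by (rule LeastI)
    \<comment> \<open>The threshold on \<open>n\<close> ensures this. It yields
      \<open>Q <= (Q - 1) ^ 2\<close> and \<open>Q / 2 <= Q - 1\<close>, so passing from
      \<open>Q - 1\<close> to \<open>Q\<close> costs only the factor
      \<open>2 ^ (r + 1)\<close>.\<close>
    have Q4: "Q \<ge> 4"
    proof (rule ccontr)
      assume "\<not> Q \<ge> 4"
      then have "Q ^ (Q ^ r) \<le> 3 ^ (Q ^ r)" by (intro power_mono) auto
      also have "(3::nat) ^ (Q ^ r) \<le> 3 ^ (3 ^ r)"
        using \<open>\<not> Q \<ge> 4\<close> by (intro power_increasing power_mono) auto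
      finally show False using n Q by simp
    qed
    have Qmin: "(Q - 1) ^ ((Q - 1) ^ r) < n"
      using not_less_Least[of "Q - 1" "\<lambda>Q. n \<le> Q ^ (Q ^ r)"] Q4 by (simp add: Q_def [symmetric])
    define y where "y = ln (real n)"
    define L where "L = ln (real Q)"
    have ln3: "ln (3::real) \<ge> 1" using exp_le by (simp add: ln_ge_iff)
    have L1: "L \<ge> 1"
    proof -
      have "ln 3 \<le> L" using Q4 by (simp add: L_def)
      then show ?thesis using ln3 by simp
    qed
    have y: "ln y \<ge> 1" "y \<ge> 3"
    proof -
      have "(3::nat) ^ 1 \<le> 3 ^ r" using assms by (intro power_increasing) auto
      then have "(3::nat) ^ 3 \<le> 3 ^ (3 ^ r)" by (intro power_increasing) auto
      with n have "(3::nat) ^ 3 \<le> n" by linarith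
      then have "ln (3 ^ 3 :: real) \<le> y" unfolding y_def
        by (metis ln_mono of_nat_le_iff of_nat_numeral of_nat_power zero_less_numeral zero_less_power)
      moreover have "ln (3 ^ 3 :: real) = 3 * ln 3" by (subst ln_realpow) auto
      ultimately show "y \<ge> 3" using ln3 by simp
      then show "ln y \<ge> 1" using ln3 by (meson ln_mono order_trans zero_less_numeral)
    qed
    have key: "real Q ^ r * L \<le> 2 ^ (r + 1) * y"
    proof -
      have "L / 2 \<le> ln (real (Q - 1))"
      proof -
        have "real Q \<le> real (Q - 1) ^ 2"
        proof -
          have "4 * 1 \<le> real Q * (real Q - 3)" using Q4 by (intro mult_mono) auto
          then show ?thesis using Q4 by (simp add: power2_eq_square of_nat_diff algebra_simps)
        qed
        then have "L \<le> ln (real (Q - 1) ^ 2)" unfolding L_def using Q4 by (intro ln_mono) auto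
        then show ?thesis using Q4 by (simp add: ln_realpow)
      qed
      moreover have "(real Q / 2) ^ r \<le> real (Q - 1) ^ r"
        using Q4 by (intro power_mono) (auto simp: of_nat_diff)
      ultimately have "(real Q / 2) ^ r * (L / 2) \<le> real (Q - 1) ^ r * ln (real (Q - 1))"
        using L1 by (intro mult_mono) auto
      also have "\<dots> = ln (real ((Q - 1) ^ ((Q - 1) ^ r)))"
        using Q4 by (simp add: ln_realpow)
      also have "\<dots> \<le> y" unfolding y_def using Qmin Q4 by (intro ln_mono) (auto simp del: of_nat_power)
      finally show ?thesis by (simp add: power_divide field_simps)
    qed
    have L_le: "L \<le> (real r + 2) * ln y"
    proof -
      have "real Q ^ r * 1 \<le> 2 ^ (r + 1) * y"
        using key L1 by (meson mult_left_mono order_trans zero_le_power of_nat_0_le_iff)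
      then have "ln (real Q ^ r * 1) \<le> ln (2 ^ (r + 1) * y)" using Q4 by (intro ln_mono) auto
      then have "real r * L \<le> (real r + 1) * ln 2 + ln y"
        using Q4 y by (simp add: ln_mult ln_realpow L_def algebra_simps)
      moreover have "1 * L \<le> real r * L" using assms L1 by (intro mult_right_mono) auto
      moreover have "(real r + 1) * ln 2 \<le> (real r + 1) * ln y"
        using y ln_2_less_1 by (intro mult_left_mono) auto
      ultimately show ?thesis by (simp add: algebra_simps)
    qed
    define a where "a = (real r - 1) / real r"
    define T where "T = y powr (1 / real r) * ln y powr a"
    have T: "T > 0" using y by (simp add: T_def)
    have Tr: "T ^ r = y * ln y ^ (r - 1)"
    proof -
      have "T ^ r = T powr real r" using T by (simp add: powr_realpow)
      also have "\<dots> = y powr 1 * ln y powr real (r - 1)"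
        unfolding T_def a_def using assms y by (simp add: powr_mult powr_powr of_nat_diff)
      also have "\<dots> = y * ln y ^ (r - 1)" using y by (subst powr_realpow) auto
      finally show ?thesis .
    qed
    have QL: "real Q * L \<le> C * T"
    proof (rule power_le_imp_le_base)
      have r: "Suc (r - 1) = r" using assms by simp
      have "(real Q * L) ^ r = real Q ^ r * L * L ^ (r - 1)"
        using power_Suc[of L "r - 1"] unfolding r by (simp add: power_mult_distrib)
      also have "\<dots> \<le> 2 ^ (r + 1) * y * ((real r + 2) * ln y) ^ (r - 1)"
        by (rule mult_mono[OF key power_mono[OF L_le]]) (use L1 y in auto)
      also have "\<dots> = C * T ^ r" by (simp add: C_def Tr power_mult_distrib)
      also have "\<dots> \<le> C ^ r * T ^ r"
        using C1 T assms by (intro mult_right_mono self_le_power) auto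
      finally show "(real Q * L) ^ Suc (r - 1) \<le> (C * T) ^ Suc (r - 1)"
        unfolding r by (simp add: power_mult_distrib)
      show "0 \<le> C * T" using C1 T by simp
    qed
    have "ln (real (K * (B * Q) ^ (B * Q))) = ln (real K) + real B * (real Q * (ln (real B) + L))"
      using assms Q4 by (simp add: ln_mult ln_realpow L_def)
    also have "\<dots> \<le> ln (real K) * (real Q * L) + real B * (real Q * (L * (ln (real B) + 1)))"
    proof (intro add_mono mult_left_mono)
      have "1 * 1 \<le> real Q * L" using Q4 L1 by (intro mult_mono) auto
      then have "ln (real K) * 1 \<le> ln (real K) * (real Q * L)"
        using assms by (intro mult_left_mono) auto
      then show "ln (real K) \<le> ln (real K) * (real Q * L)" by simp
      have "ln (real B) * 1 \<le> ln (real B) * L" using assms L1 by (intro mult_left_mono) auto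
      then show "ln (real B) + L \<le> L * (ln (real B) + 1)" by (simp add: algebra_simps)
    qed auto
    also have "\<dots> = C' * (real Q * L)" by (simp add: C'_def algebra_simps)
    also have "\<dots> \<le> C' * (C * T)" using QL C' by (intro mult_left_mono) auto
    \<comment> \<open>This matches the stated exponent: \<open>1 - a = 1 / r\<close>, and
      \<open>n\<close> is \<open>exp y\<close>.\<close>
    also have "T = y * (ln y / y) powr a"
    proof -
      have "y * (ln y / y) powr a = y powr (1 - a) * ln y powr a"
        using y by (simp add: powr_divide powr_diff)
      moreover have "1 - a = 1 / real r" using assms by (simp add: a_def field_simps)
      ultimately show ?thesis by (simp add: T_def)
    qed
    finally have "ln (real (K * (B * Q) ^ (B * Q))) \<le> C' * C * (ln y / y) powr a * y"
      by (simp add: mult_ac)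
    moreover have "real (K * (B * Q) ^ (B * Q)) > 0" using assms Q4 by simp
    ultimately have "real (K * (B * Q) ^ (B * Q)) \<le> exp (C' * C * (ln y / y) powr a * y)"
      by (metis exp_le_cancel_iff exp_ln)
    also have "\<dots> = real n powr (C' * C * (ln y / y) powr a)"
      using n by (simp add: powr_def y_def)
    finally show "\<exists>Q\<ge>1. n \<le> Q ^ (Q ^ r) \<and>
        real (K * (B * Q) ^ (B * Q))
          \<le> real n powr (C' * C * (ln (ln (real n)) / ln (real n)) powr ((real r - 1) / real r))"
      using Q Q4 by (intro exI[of _ Q]) (simp add: y_def a_def)
  qed
qed

text \<open>The exponent without \<open>c\<close> is positive for each \<open>n > 1\<close>, as no
  integer equals \<open>e\<close> and so \<open>ln (ln n)\<close> is non-zero; \<open>c\<close> is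
  chosen above its finitely many reciprocals.\<close>

lemma linear_bound_finite:
  fixes a :: real
  shows "\<exists>c>0. \<forall>n. 1 < n \<longrightarrow> n \<le> m \<longrightarrow>
    real n \<le> real n powr (c * (ln (ln (real n)) / ln (real n)) powr a)"
proof -
  define E where "E n = (ln (ln (real n)) / ln (real n)) powr a" for n :: nat
  have E: "E n > 0" if "n > 1" for n
  proof -
    have "ln (real n) \<noteq> 1"
    proof (cases "n = 2")
      case False
      with that have "real n \<ge> 3" by simp
      moreover have "exp 1 < (3::real)"
      proof -
        \<comment> \<open>The bound \<open>1 + x + x^2\<close> at \<open>x = 1/4\<close>; its fourth
          power is still below 3.\<close>
        have "exp (1 / 4 :: real) \<le> 21 / 16" using exp_bound[of "1 / 4 :: real"] by (simp add: power2_eq_square)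
        then have "exp (1 / 4 :: real) ^ 4 \<le> (21 / 16) ^ 4" by (intro power_mono) auto
        then show ?thesis by (simp add: power_divide flip: exp_of_nat_mult)
      qed
      ultimately have "exp 1 < real n" by linarith
      then show ?thesis using that by (metis exp_ln less_irrefl of_nat_0_less_iff order.strict_trans zero_less_one)
    qed (use ln_2_less_1 in simp)
    moreover have "ln (real n) > 0" using that by simp
    ultimately show ?thesis by (simp add: E_def)
  qed
  define c where "c = 1 + (\<Sum>n\<in>{2..m}. 1 / E n)"
  have "c > 0" unfolding c_def using E by (intro add_pos_nonneg sum_nonneg) (auto simp: less_imp_le)
  moreover have "real n \<le> real n powr (c * E n)" if "1 < n" "n \<le> m" for n
  proof -
    have "1 / E n \<le> (\<Sum>n\<in>{2..m}. 1 / E n)"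
      using that E by (intro member_le_sum) (auto simp: less_imp_le)
    then have "1 / E n \<le> c" by (simp add: c_def)
    then have "1 \<le> c * E n" using E[OF that(1)] by (simp add: field_simps)
    then have "real n powr 1 \<le> real n powr (c * E n)" using that by (intro powr_mono) auto
    then show ?thesis using that by simp
  qed
  ultimately show ?thesis unfolding E_def by blast
qed

section \<open>Fixing the primes and assembling the protocol\<close>

lemma exists_prime_power_between:
  fixes p Q :: nat
  assumes "p > 1" "Q \<ge> 1"
  shows "\<exists>e. Q < p ^ e \<and> p ^ e \<le> p * Q"
proof -
  define e where "e = (LEAST e. Q < p ^ e)"
  have "Q < p ^ Q" using assms(1) by (simp add: power_gt_expt)
  then have e: "Q < p ^ e" unfolding e_def by (rule LeastI)
  then obtain e' where e': "e = Suc e'" using assms(2) by (cases e) auto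
  then have "p ^ e' \<le> Q"
    using not_less_Least[of e' "\<lambda>e. Q < p ^ e"] by (simp add: e_def [symmetric])
  with e e' show ?thesis by (intro exI[of _ e]) simp
qed

text \<open>Start from 7 and 73 with three monomials and keep adding larger primes, each doubling
  the number. They are odd, hence non-zero in characteristic 2.\<close>

lemma exists_decoder:
  assumes two: "(2 :: 'a::alg_closed_field) = 0" and "r \<ge> 2"
  shows "\<exists>P. finite P \<and> card P = r \<and> (\<forall>p\<in>P. prime p) \<and>
    (\<exists>(g::'a) c b. decoder (\<Prod>P) g (3 * 2 ^ (r - 2)) c b)"
  using assms(2)
proof (induction r rule: nat_induct_at_least)
  case base
  have "prime (7::nat)" "prime (73::nat)" by simp_all
  then show ?case
    using decoder_511[OF two] by (intro exI[of _ "{7, 73}"]) simp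
next
  case (Suc r)
  then obtain P and g :: 'a and c b where P: "finite P" "card P = r" "\<And>p. p \<in> P \<Longrightarrow> prime p"
    and dec: "decoder (\<Prod>P) g (3 * 2 ^ (r - 2)) c b" by blast
  obtain p where p: "prime p" "p > Max (insert 2 P)" using bigger_prime by blast
  then have new: "p \<notin> P" "p > 2" using P(1) by auto
  have "coprime (\<Prod>P) p"
    using P p new by (intro prod_coprime_left primes_coprime) auto
  moreover have "(of_nat p :: 'a) \<noteq> 0"
    using prime_odd_nat[OF p(1) new(2)] by (simp add: of_nat_eq_of_bool_odd[OF two])
  ultimately obtain g' :: 'a and c' b' where
    "decoder (\<Prod>P * p) g' (3 * 2 ^ (r - 2) * 2) c' b'"
    using decoder_mult_prime[OF dec p(1)] by blast
  moreover have "\<Prod>P * p = \<Prod>(insert p P)" using P new by (simp add: mult.commute)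
  moreover have "3 * 2 ^ (r - 2) * 2 = (3 * 2 ^ (Suc r - 2) :: nat)"
  proof -
    have "Suc r - 2 = Suc (r - 2)" using Suc.hyps by simp
    then show ?thesis by simp
  qed
  ultimately show ?case
    using P p new by (intro exI[of _ "insert p P"]) auto
qed

lemma bit_alg_closure_two: "(2 :: bit alg_closure) = 0"
proof -
  have "(2 :: bit alg_closure) = to_ac 2" by (rule to_ac_numeral [symmetric])
  also have "(2 :: bit) = 0" by simp
  finally show ?thesis by simp
qed

text \<open>The primes are fixed by \<open>r\<close> alone; only the exponents \<open>e p\<close>
  vary with \<open>Q\<close>. Thus \<open>m\<close> and the largest prime \<open>s\<close> enter the
  constants \<open>K\<close> and \<open>B\<close>.\<close>

lemma exists_pir_from_parameters:
  fixes r :: nat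
  assumes r: "r > 1"
  shows "\<exists>K B. K \<ge> 1 \<and> B \<ge> 1 \<and> (\<forall>n Q. Q \<ge> 1 \<longrightarrow> n \<le> Q ^ (Q ^ r) \<longrightarrow>
    (\<exists>P. pir_protocol (3 * 2 ^ (r - 2)) n P \<and>
      communication_complexity (3 * 2 ^ (r - 2)) P \<le> K * (B * Q) ^ (B * Q)))"
proof -
  define k :: nat where "k = 3 * 2 ^ (r - 2)"
  obtain S and g :: "bit alg_closure" and c b where S: "finite S" "card S = r" "\<And>p. p \<in> S \<Longrightarrow> prime p"
    and dec: "decoder (\<Prod>S) g k c b"
    using exists_decoder[OF bit_alg_closure_two, of r] r unfolding k_def by auto
  define m where "m = \<Prod>S"
  have m: "m > 0" using S by (auto simp: m_def prime_gt_0_nat intro!: prod_pos)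
  define s where "s = Max S"
  have s: "p \<le> s" if "p \<in> S" for p using that S by (simp add: s_def)
  have "S \<noteq> {}" using S r by auto
  then have s1: "s \<ge> 1" using S s by (metis all_not_in_conv order_trans prime_ge_1_nat)
  have "\<exists>P. pir_protocol k n P \<and>
      communication_complexity k P \<le> (k * m * (r + 2)) * ((2 * r * s) * Q) ^ ((2 * r * s) * Q)"
    if Q: "Q \<ge> 1" and n: "n \<le> Q ^ (Q ^ r)" for n Q
  proof -
    have "\<exists>e. Q < p ^ e \<and> p ^ e \<le> s * Q" if "p \<in> S" for p
      using exists_prime_power_between[OF prime_gt_1_nat[OF S(3)[OF that]] Q] s[OF that]
      by (meson mult_le_mono1 order_trans)
    then obtain e where e: "\<And>p. p \<in> S \<Longrightarrow> Q < p ^ e p" "\<And>p. p \<in> S \<Longrightarrow> p ^ e p \<le> s * Q"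
      by metis
    define M where "M = (\<Prod>p\<in>S. p ^ e p)"
    \<comment> \<open>Then \<open>N / (M - 1) = M\<close>, so \<open>N choose (M - 1)\<close> is at
      least \<open>M ^ (M - 1)\<close>, which exceeds \<open>Q ^ (Q ^ r)\<close> or equals it
      because \<open>M > Q ^ r\<close>.\<close>
    define N where "N = (M - 1) * M"
    have "(\<Prod>p\<in>S. Q + 1) \<le> M" unfolding M_def by (intro prod_mono) (use e in \<open>auto simp: Suc_le_eq\<close>)
    then have "(Q + 1) ^ r \<le> M" by (simp add: S)
    moreover have "Q ^ r < (Q + 1) ^ r" using r by (intro power_strict_mono) auto
    ultimately have MQ: "Q ^ r < M" by linarith
    have "Q ^ 1 \<le> Q ^ r" using Q r by (intro power_increasing) auto
    then have QM: "Q \<le> M" "M > 1" using MQ Q by auto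
    have "M \<le> (\<Prod>p\<in>S. s * Q)" unfolding M_def by (intro prod_mono) (use e in auto)
    then have M_le: "M \<le> (s * Q) ^ r" by (simp add: S)
    have "n \<le> N choose (M - 1)"
    proof -
      have "n \<le> Q ^ (Q ^ r)" by (rule n)
      also have "\<dots> \<le> M ^ (Q ^ r)" using QM by (intro power_mono) auto
      also have "\<dots> \<le> M ^ (M - 1)" using QM MQ by (intro power_increasing) auto
      finally have "real n \<le> real M ^ (M - 1)" by (metis of_nat_le_iff of_nat_power)
      also have "\<dots> = (real N / real (M - 1)) ^ (M - 1)" using QM by (simp add: N_def)
      also have "\<dots> \<le> real (N choose (M - 1))"
        by (rule binomial_ge_n_over_k_pow_k) (use QM in \<open>simp add: N_def\<close>)
      finally show ?thesis by simp
    qed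
    then obtain u v where mv:
      "matching_vectors m n (1 + (\<Sum>p\<in>S. N choose (p ^ e p - 1))) u v"
      using exists_matching_vectors[OF S(1,3), of n N e] by (auto simp: M_def m_def)
    define h where "h = 1 + (\<Sum>p\<in>S. N choose (p ^ e p - 1))"
    \<comment> \<open>The exponent arises from \<open>N <= (s * Q) ^ (2 * r)\<close> and
      \<open>p ^ e p <= s * Q\<close>; the base is enlarged to agree with it.\<close>
    define Y where "Y = ((2 * r * s) * Q) ^ ((2 * r * s) * Q)"
    have Y1: "Y \<ge> 1" using Q r s1 by (simp add: Y_def)
    have "N choose (p ^ e p - 1) \<le> Y" if p: "p \<in> S" for p
    proof (cases "p ^ e p - 1 \<le> N")
      case True
      have "N choose (p ^ e p - 1) \<le> N ^ (p ^ e p - 1)" by (rule binomial_le_pow[OF True])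
      also have "\<dots> \<le> N ^ (s * Q)"
        using e(2)[OF p] QM by (intro power_increasing) (auto simp: N_def)
      also have "\<dots> \<le> (((s * Q) ^ r) ^ 2) ^ (s * Q)"
      proof (rule power_mono)
        have "N \<le> M * M" by (simp add: N_def)
        also have "\<dots> \<le> (s * Q) ^ r * (s * Q) ^ r" using M_le by (intro mult_mono) auto
        finally show "N \<le> ((s * Q) ^ r) ^ 2" by (simp add: power2_eq_square)
      qed simp
      also have "\<dots> = (s * Q) ^ ((2 * r * s) * Q)"
        by (simp add: mult_ac flip: power_mult)
      also have "\<dots> \<le> Y" unfolding Y_def using r by (intro power_mono) auto
      finally show ?thesis .
    qed (simp add: binomial_eq_0)
    then have "h \<le> 1 + r * Y"
      using sum_bounded_above[of S "\<lambda>p. N choose (p ^ e p - 1)" Y] S by (simp add: h_def)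
    then have "h + 1 \<le> (r + 2) * Y" using Y1 by (simp add: algebra_simps)
    then have "k * m * (h + 1) \<le> k * m * ((r + 2) * Y)" by (rule mult_le_mono2)
    then have "k * (h * m + m) \<le> k * m * (r + 2) * Y" by (simp add: algebra_simps)
    then show ?thesis
      using pir_from_decoder[OF bit_alg_closure_two m dec[folded m_def] mv[folded h_def]]
      unfolding Y_def by auto
  qed
  moreover have "k * m * (r + 2) \<ge> 1" "2 * r * s \<ge> 1"
    using m r s1 by (auto simp: k_def Suc_le_eq)
  ultimately show ?thesis unfolding k_def by blast
qed

theorem theorem5p2:
  fixes r :: nat
  assumes "r > 1"
  shows "\<exists>c::real. c > 0 \<and>
    (\<forall>n::nat. n > 1 \<longrightarrow>
      (\<exists>(k::nat) P. k \<le> 3 * 2 ^ (r - 2) \<and> pir_protocol k n P \<and>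
        real (communication_complexity k P)
          \<le> real n powr (c * (ln (ln (real n)) / ln (real n)) powr ((real r - 1) / real r))))"
proof -
  define E where "E n = (ln (ln (real n)) / ln (real n)) powr ((real r - 1) / real r)" for n :: nat
  obtain K B where KB: "K \<ge> 1" "B \<ge> 1" and pir: "\<And>n Q. Q \<ge> 1 \<Longrightarrow> n \<le> Q ^ (Q ^ r) \<Longrightarrow>
      \<exists>P. pir_protocol (3 * 2 ^ (r - 2)) n P \<and>
        communication_complexity (3 * 2 ^ (r - 2)) P \<le> K * (B * Q) ^ (B * Q)"
    using exists_pir_from_parameters[OF assms] by blast
  obtain c where c: "c > 0" "\<And>n. n > 3 ^ (3 ^ r) \<Longrightarrow> \<exists>Q\<ge>1. n \<le> Q ^ (Q ^ r) \<and>
      real (K * (B * Q) ^ (B * Q)) \<le> real n powr (c * E n)"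
    using pir_bound_asymptotics[OF assms KB] unfolding E_def by blast
  obtain c' where c': "c' > 0" "\<And>n. 1 < n \<Longrightarrow> n \<le> 3 ^ (3 ^ r) \<Longrightarrow> real n \<le> real n powr (c' * E n)"
    using linear_bound_finite[of "3 ^ (3 ^ r)" "(real r - 1) / real r"] unfolding E_def by blast
  \<comment> \<open>As \<open>E n\<close> is non-negative and \<open>n > 1\<close>, one constant
    serves both the small and the large \<open>n\<close>.\<close>
  have mono: "real n powr (a * E n) \<le> real n powr (max c c' * E n)" if "n > 1" "a \<le> max c c'" for n a
    using that by (intro powr_mono mult_right_mono) (auto simp: E_def)
  have "\<exists>k P. k \<le> 3 * 2 ^ (r - 2) \<and> pir_protocol k n P \<and>
      real (communication_complexity k P) \<le> real n powr (max c c' * E n)" if n: "n > 1" for n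
  proof (cases "n \<le> 3 ^ (3 ^ r)")
    case True
    obtain P where "pir_protocol 1 n P" "communication_complexity 1 P = n"
      using pir_send_database by blast
    moreover have "real n \<le> real n powr (max c c' * E n)"
      using c'(2)[OF n True] mono[OF n, of c'] by simp
    moreover have "1 \<le> (3 * 2 ^ (r - 2) :: nat)" by simp
    ultimately show ?thesis by metis
  next
    case False
    then obtain Q where Q: "Q \<ge> 1" "n \<le> Q ^ (Q ^ r)"
      "real (K * (B * Q) ^ (B * Q)) \<le> real n powr (c * E n)"
      using c(2) by (meson not_le)
    obtain P where P: "pir_protocol (3 * 2 ^ (r - 2)) n P"
      "communication_complexity (3 * 2 ^ (r - 2)) P \<le> K * (B * Q) ^ (B * Q)"
      using pir[OF Q(1,2)] by blast
    have "real (communication_complexity (3 * 2 ^ (r - 2)) P) \<le> real (K * (B * Q) ^ (B * Q))"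
      using P(2) of_nat_le_iff by blast
    also note Q(3)
    also have "real n powr (c * E n) \<le> real n powr (max c c' * E n)"
      using mono[OF n, of c] by simp
    finally show ?thesis using P(1) by blast
  qed
  then show ?thesis
    using c(1) unfolding E_def by (intro exI[of _ "max c c'"]) auto
qed

end
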